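(* For a $1$-dimensional Dunkl process $(X_t^\lambda)_{t\ge0}$ with multiplicity $k>0$, drift $\lambda\in\mathbb R$, $\lambda\ne0$, and start in $0$, the random variables $(X_t^\lambda-t\lambda)/\sqrt t$ tend in distribution to the standard normal distribution $N(0,1)$ for $t\to\infty$.
   Context: One-dimensional Dunkl setting: $N=1$, root system $R=\{\pm1\}$, multiplicity a number $k>0$. The Dunkl operator is $Tf(x)=f'(x)+k\frac{f(x)-f(-x)}{x}$, and for $w\in\mathbb C$ the Dunkl kernel $E_k(\cdot,w)$ is the unique holomorphic function on $\mathbb C$ with $TE_k(\cdot,w)=w\,E_k(\cdot,w)$ and $E_k(0,w)=1$. A $1$-dimensional Dunkl process with multiplicity $k$ and drift $\lambda$ is a time-homogeneous Feller process on $\mathbb R$ with transition kernels $$K_t(x,A)=\frac{e^{-\lambda^2t/2}}{2^{k+1/2}\Gamma(k+1/2)\,t^{k+1/2}}\int_Ae^{-(x^2+y^2)/(2t)}\,\frac{E_k(\frac x{\sqrt t},\frac y{\sqrt t})\,E_k(y,\lambda)}{E_k(x,\lambda)}\,|y|^{2k}\,dy$$ for $t>0$, $x\in\mathbb R$ and Borel sets $A\subset\mathbb R$. *)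

theory Defs
  imports "HOL-Probability.Probability"
begin

section \<open>Dunkl operator and Dunkl kernel\<close>

text \<open>At the origin the difference quotient \<open>(f z - f (- z)) / z\<close> is read as its limit
  \<open>2 f'(0)\<close>, so that \<open>T f\<close> is again holomorphic for holomorphic \<open>f\<close>. (Division by zero
  would otherwise silently drop this term.)\<close>

definition dunkl_operator :: "real \<Rightarrow> (complex \<Rightarrow> complex) \<Rightarrow> complex \<Rightarrow> complex" where
  "dunkl_operator k f z =
     deriv f z + of_real k * (if z = 0 then 2 * deriv f 0 else (f z - f (- z)) / z)"

definition dunkl_kernel :: "real \<Rightarrow> complex \<Rightarrow> complex \<Rightarrow> complex" where
  "dunkl_kernel k z w =
     (THE f. f holomorphic_on UNIV \<and> (\<forall>u. dunkl_operator k f u = w * f u) \<and> f 0 = 1) z"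

text \<open>The Dunkl kernel is real-valued on real arguments.\<close>

definition dunkl_kernel_real :: "real \<Rightarrow> real \<Rightarrow> real \<Rightarrow> real" where
  "dunkl_kernel_real k x y = Re (dunkl_kernel k (of_real x) (of_real y))"


section \<open>Feller processes with given transition kernels\<close>

definition C0_functions :: "(real \<Rightarrow> real) set" where
  "C0_functions = {f. continuous_on UNIV f \<and> (f \<longlongrightarrow> 0) at_infinity}"

text \<open>\<open>K t x\<close> is the law at time \<open>t\<close> of the process started in \<open>x\<close>; only \<open>t \<ge> 0\<close> matters.\<close>

definition feller_kernels :: "(real \<Rightarrow> real \<Rightarrow> real measure) \<Rightarrow> bool" where
  "feller_kernels K \<longleftrightarrow>
     (\<forall>t\<ge>0. K t \<in> borel \<rightarrow>\<^sub>M prob_algebra borel) \<and>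
     (\<forall>x. K 0 x = return borel x) \<and>
     (\<forall>s\<ge>0. \<forall>t\<ge>0. \<forall>x. K (s + t) x = K s x \<bind> K t) \<and>
     (\<forall>t\<ge>0. \<forall>f\<in>C0_functions. (\<lambda>x. \<integral>y. f y \<partial>K t x) \<in> C0_functions) \<and>
     (\<forall>f\<in>C0_functions. uniform_limit UNIV (\<lambda>t x. \<integral>y. f y \<partial>K t x) f (at_right 0))"

definition natural_filtration :: "'a measure \<Rightarrow> (real \<Rightarrow> 'a \<Rightarrow> real) \<Rightarrow> real \<Rightarrow> 'a measure" where
  "natural_filtration M X s =
     sigma (space M) {X u -` A \<inter> space M |u A. 0 \<le> u \<and> u \<le> s \<and> A \<in> sets borel}"

definition markov_process ::
    "'a measure \<Rightarrow> (real \<Rightarrow> 'a \<Rightarrow> real) \<Rightarrow> (real \<Rightarrow> real \<Rightarrow> real measure) \<Rightarrow> bool" where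
  "markov_process M X K \<longleftrightarrow>
     prob_space M \<and>
     (\<forall>t\<ge>0. X t \<in> borel_measurable M) \<and>
     (\<forall>s\<ge>0. \<forall>t\<ge>0. \<forall>A\<in>sets borel. AE \<omega> in M.
        real_cond_exp M (natural_filtration M X s) (indicator (X (s + t) -` A \<inter> space M)) \<omega> =
        measure (K t (X s \<omega>)) A)"

definition feller_process ::
    "'a measure \<Rightarrow> (real \<Rightarrow> 'a \<Rightarrow> real) \<Rightarrow> (real \<Rightarrow> real \<Rightarrow> real measure) \<Rightarrow> bool" where
  "feller_process M X K \<longleftrightarrow> feller_kernels K \<and> markov_process M X K"


section \<open>Dunkl processes with drift\<close>

definition dunkl_transition_density :: "real \<Rightarrow> real \<Rightarrow> real \<Rightarrow> real \<Rightarrow> real \<Rightarrow> real" where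
  "dunkl_transition_density k l t x y =
     exp (- l\<^sup>2 * t / 2) / (2 powr (k + 1/2) * Gamma (k + 1/2) * t powr (k + 1/2)) *
     (exp (- (x\<^sup>2 + y\<^sup>2) / (2 * t)) *
      (dunkl_kernel_real k (x / sqrt t) (y / sqrt t) * dunkl_kernel_real k y l
         / dunkl_kernel_real k x l) *
      \<bar>y\<bar> powr (2 * k))"

definition dunkl_transition :: "real \<Rightarrow> real \<Rightarrow> real \<Rightarrow> real \<Rightarrow> real measure" where
  "dunkl_transition k l t x =
     (if t = 0 then return borel x
      else density lborel (\<lambda>y. ennreal (dunkl_transition_density k l t x y)))"

definition dunkl_process :: "'a measure \<Rightarrow> (real \<Rightarrow> 'a \<Rightarrow> real) \<Rightarrow> real \<Rightarrow> real \<Rightarrow> bool" where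
  "dunkl_process M X k l \<longleftrightarrow> feller_process M X (dunkl_transition k l)"


section \<open>Convergence in distribution along a filter\<close>

text \<open>The library's \<open>weak_conv_m\<close> is restricted to sequences; this is the same definition for
  families indexed by an arbitrary filter.\<close>

definition weak_conv_along :: "('i \<Rightarrow> real measure) \<Rightarrow> real measure \<Rightarrow> 'i filter \<Rightarrow> bool" where
  "weak_conv_along \<mu> N F \<longleftrightarrow>
     (\<forall>x. isCont (cdf N) x \<longrightarrow> ((\<lambda>i. cdf (\<mu> i) x) \<longlongrightarrow> cdf N x) F)"

lemma weak_conv_along_sequentially:
  "weak_conv_along \<mu> N sequentially \<longleftrightarrow> weak_conv_m \<mu> N"
  by (simp add: weak_conv_along_def weak_conv_m_def weak_conv_def)

end

theory Submission
  imports Defs "HOL-Complex_Analysis.Complex_Analysis"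
begin

text \<open>The law of \<open>X t\<close> is the transition kernel started in \<open>0\<close>. After the affine rescaling its
  density at \<open>z\<close> is, with \<open>u = l\<^sup>2 t + l z sqrt t\<close>, a constant times
  \<open>exp (- z\<^sup>2 / 2) (u / (l\<^sup>2 t)) powr k\<close> times \<open>u powr k * exp (- u) * E (u, 1)\<close>. Whatever the sign
  of \<open>l\<close>, \<open>u\<close> tends to infinity and \<open>u / (l\<^sup>2 t)\<close> to \<open>1\<close>, so the asymptotics of the Dunkl kernel give
  pointwise convergence to the normal density. The kernel is a Beta-type Laplace integral, which
  yields these asymptotics with the exact constant. As a Feller kernel has total mass \<open>1\<close>, Scheffe's
  lemma upgrades pointwise convergence of the densities to convergence of the distribution
  functions; no estimate of the density on the negative half-line is required.\<close>

section \<open>Power series of the Dunkl kernel\<close>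

text \<open>For \<open>n > 0\<close> the Dunkl operator maps \<open>z ^ n\<close> to
  \<open>(n + k * (1 - (-1) ^ n)) * z ^ (n - 1)\<close>. The coefficients are the reciprocals of the
  products of these factors, a deformed factorial.\<close>

primrec dunkl_coeff :: "real \<Rightarrow> nat \<Rightarrow> real" where
  "dunkl_coeff k 0 = 1"
| "dunkl_coeff k (Suc n) = dunkl_coeff k n / (real (Suc n) + k * (1 - (-1) ^ Suc n))"

lemma dunkl_coeff_denominator_pos:
  assumes "k > 0"
  shows "real (Suc n) + k * (1 - (-1) ^ Suc n) > 0"
  using assms by (cases "even n") (auto intro: add_pos_pos)

lemma dunkl_coeff_pos: "k > 0 \<Longrightarrow> dunkl_coeff k n > 0"
  by (induction n) (simp, simp only: dunkl_coeff.simps divide_pos_pos dunkl_coeff_denominator_pos)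

text \<open>Each denominator is at least \<open>Suc n\<close>, so the exponential series dominates
  and the power series converges everywhere.\<close>

lemma dunkl_coeff_le: "k > 0 \<Longrightarrow> dunkl_coeff k n \<le> 1 / fact n"
proof (induction n)
  case (Suc n)
  have "dunkl_coeff k n / (real (Suc n) + k * (1 - (-1) ^ Suc n)) \<le> (1 / fact n) / Suc n"
    using Suc by (intro frac_le) (cases "even n"; simp)+
  then show ?case by (simp del: power_Suc add: field_simps)
qed simp

lemma summable_dunkl_coeff:
  fixes z :: "'a :: {real_normed_field, banach}"
  assumes "k > 0"
  shows "summable (\<lambda>n. of_real (dunkl_coeff k n) * z ^ n)"
proof (rule summable_comparison_test')
  show "summable (\<lambda>n. inverse (fact n) * norm z ^ n)"
    by (rule summable_exp)
  show "norm (of_real (dunkl_coeff k n) * z ^ n) \<le> inverse (fact n) * norm z ^ n" for n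
    using mult_right_mono[OF dunkl_coeff_le[OF assms, of n], of "norm z ^ n"]
      dunkl_coeff_pos[OF assms, of n]
    by (simp add: norm_mult norm_power inverse_eq_divide)
qed

text \<open>This is the kernel with second argument \<open>1\<close>; the general kernel arises from
  it by dilating the variable.\<close>

definition dunkl_series :: "real \<Rightarrow> complex \<Rightarrow> complex" where
  "dunkl_series k z = (\<Sum>n. of_real (dunkl_coeff k n) * z ^ n)"

lemma dunkl_series_sums:
  "k > 0 \<Longrightarrow> (\<lambda>n. of_real (dunkl_coeff k n) * z ^ n) sums dunkl_series k z"
  unfolding dunkl_series_def by (intro summable_sums summable_dunkl_coeff)

lemma dunkl_series_0 [simp]: "dunkl_series k 0 = 1"
  unfolding dunkl_series_def by (subst powser_zero) simp

lemma has_field_derivative_dunkl_series: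
  assumes "k > 0"
  shows "(dunkl_series k has_field_derivative
           (\<Sum>n. diffs (\<lambda>n. of_real (dunkl_coeff k n)) n * z ^ n)) (at z)"
  unfolding dunkl_series_def[abs_def]
  by (rule termdiffs_strong_converges_everywhere) (rule summable_dunkl_coeff[OF assms])

lemma dunkl_series_deriv_sums:
  assumes "k > 0"
  shows "(\<lambda>n. diffs (\<lambda>n. of_real (dunkl_coeff k n)) n * z ^ n) sums deriv (dunkl_series k) z"
  unfolding DERIV_imp_deriv[OF has_field_derivative_dunkl_series[OF assms]]
  by (intro summable_sums termdiff_converges_all summable_dunkl_coeff assms)

lemma holomorphic_dunkl_series: "k > 0 \<Longrightarrow> dunkl_series k holomorphic_on A"
  using has_field_derivative_dunkl_series
  by (metis holomorphic_on_open holomorphic_on_subset open_UNIV subset_UNIV)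

section \<open>Existence and uniqueness for the eigenvalue equation\<close>

text \<open>Termwise, the operator multiplies the coefficient of index \<open>Suc n\<close> by the
  denominator of its recursion, which restores the coefficient of index \<open>n\<close>.\<close>

lemma dunkl_operator_series:
  assumes k: "k > 0"
  shows "dunkl_operator k (dunkl_series k) u = dunkl_series k u"
proof -
  let ?a = "\<lambda>n. of_real (dunkl_coeff k n) :: complex"
  let ?d = "if u = 0 then 2 * deriv (dunkl_series k) 0
              else (dunkl_series k u - dunkl_series k (- u)) / u"
  \<comment> \<open>Even powers cancel in the difference. At \<open>u = 0\<close> only the term
    \<open>n = 0\<close> survives, and it equals the value prescribed at the origin.\<close>
  have d: "(\<lambda>n. (1 - (-1) ^ Suc n) * ?a (Suc n) * u ^ n) sums ?d"
  proof (cases "u = 0")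
    case True
    then show ?thesis
      using powser_sums_zero[of "\<lambda>n. (1 - (-1) ^ Suc n) * ?a (Suc n)"]
        sums_unique2[OF dunkl_series_deriv_sums[OF k, of 0] powser_sums_zero]
      by (simp add: diffs_def)
  next
    case False
    have "(\<lambda>n. ?a n * u ^ n - ?a n * (- u) ^ n) sums (dunkl_series k u - dunkl_series k (- u))"
      by (intro sums_diff dunkl_series_sums k)
    then have "(\<lambda>n. ?a (Suc n) * u ^ Suc n - ?a (Suc n) * (- u) ^ Suc n) sums
                 (dunkl_series k u - dunkl_series k (- u))"
      by (subst sums_Suc_iff) simp
    then have "(\<lambda>n. (?a (Suc n) * u ^ Suc n - ?a (Suc n) * (- u) ^ Suc n) / u) sums
                 ((dunkl_series k u - dunkl_series k (- u)) / u)"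
      by (rule sums_divide)
    moreover have "(?a (Suc n) * u ^ Suc n - ?a (Suc n) * (- u) ^ Suc n) / u
                     = (1 - (-1) ^ Suc n) * ?a (Suc n) * u ^ n" for n
      using False power_minus[of u n] by (simp add: field_simps del: dunkl_coeff.simps)
    ultimately show ?thesis using False by simp
  qed
  have "(\<lambda>n. diffs ?a n * u ^ n + of_real k * ((1 - (-1) ^ Suc n) * ?a (Suc n) * u ^ n)) sums
          dunkl_operator k (dunkl_series k) u"
    unfolding dunkl_operator_def
    by (intro sums_add sums_mult d dunkl_series_deriv_sums k)
  moreover have "diffs ?a n * u ^ n + of_real k * ((1 - (-1) ^ Suc n) * ?a (Suc n) * u ^ n)
                   = ?a n * u ^ n" for n
  proof -
    have "(real (Suc n) + k * (1 - (-1) ^ Suc n)) * dunkl_coeff k (Suc n) = dunkl_coeff k n"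
      using dunkl_coeff_denominator_pos[OF k, of n] by (simp del: power_Suc)
    then have "of_real ((real (Suc n) + k * (1 - (-1) ^ Suc n)) * dunkl_coeff k (Suc n)) = ?a n"
      by (rule arg_cong)
    moreover have "diffs ?a n * u ^ n + of_real k * ((1 - (-1) ^ Suc n) * ?a (Suc n) * u ^ n)
        = of_real ((real (Suc n) + k * (1 - (-1) ^ Suc n)) * dunkl_coeff k (Suc n)) * u ^ n"
      by (simp add: diffs_def algebra_simps del: dunkl_coeff.simps power_Suc)
    ultimately show ?thesis by (simp only:)
  qed
  ultimately show ?thesis
    using sums_unique2[OF _ dunkl_series_sums[OF k]] by simp
qed

text \<open>The operator is homogeneous of degree one under dilations, so an eigenfunction for
  \<open>1\<close> dilated by \<open>w\<close> becomes one for \<open>w\<close>.\<close>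

lemma dunkl_operator_scale:
  assumes "f holomorphic_on UNIV"
  shows "dunkl_operator k (\<lambda>z. f (w * z)) u = w * dunkl_operator k f (w * u)"
proof -
  have d: "deriv (\<lambda>z. f (w * z)) x = w * deriv f (w * x)" for x
    using DERIV_chain2[OF holomorphic_derivI[OF assms open_UNIV] DERIV_cmult_Id[of w]]
    by (intro DERIV_imp_deriv) (simp add: mult.commute[of w])
  show ?thesis
    by (cases "w = 0") (simp_all add: dunkl_operator_def d distrib_left mult.left_commute)
qed

text \<open>The eigenvalue equation determines the Taylor coefficients recursively.\<close>

lemma dunkl_eigenfunction_eq_series:
  assumes k: "k > 0" and f: "f holomorphic_on UNIV" "\<And>u. dunkl_operator k f u = w * f u" "f 0 = 1"
  shows "f z = dunkl_series k (w * z)"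
proof -
  define F where "F = fps_expansion f 0"
  have F: "f has_fps_expansion F"
    unfolding F_def using f(1) by (intro analytic_at_imp_has_fps_expansion_0)
      (metis analytic_on_open analytic_on_subset open_UNIV subset_UNIV)
  have Fm: "(\<lambda>u. f (- u)) has_fps_expansion (F oo - fps_X)"
    using has_fps_expansion_compose[OF F has_fps_expansion_minus[OF has_fps_expansion_fps_X]]
    by (simp add: o_def)
  \<comment> \<open>Multiplying by \<open>u\<close> removes the quotient and its special value at
    the origin, so both sides can be expanded as formal power series.\<close>
  have eq: "u * deriv f u + of_real k * (f u - f (- u)) = u * (w * f u)" for u
    using f(2)[of u] by (cases "u = 0") (simp_all add: dunkl_operator_def field_simps)
  have "(\<lambda>u. u * deriv f u + of_real k * (f u - f (- u))) has_fps_expansion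
          fps_X * fps_deriv F + fps_const (of_real k) * (F - (F oo - fps_X))"
    by (intro fps_expansion_intros F Fm)
  moreover have "(\<lambda>u. u * (w * f u)) has_fps_expansion fps_X * (fps_const w * F)"
    by (intro fps_expansion_intros F)
  ultimately have FE: "fps_X * fps_deriv F + fps_const (of_real k) * (F - (F oo - fps_X))
                        = fps_X * (fps_const w * F)"
    unfolding eq by (rule fps_expansion_unique_complex)
  \<comment> \<open>The factor \<open>fps_X\<close> shifts the index, hence the comparison at
    \<open>Suc n\<close>; the reflection \<open>F oo - fps_X\<close> contributes the sign
    \<open>(-1) ^ Suc n\<close>.\<close>
  have rec: "(of_nat (Suc n) + of_real k * (1 - (-1) ^ Suc n)) * F $ Suc n = w * F $ n" for n
    using arg_cong[OF FE, of "\<lambda>G. fps_nth G (Suc n)"]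
    by (simp add: fps_compose_uminus') (simp add: algebra_simps)
  have co: "F $ n = of_real (dunkl_coeff k n) * w ^ n" for n
  proof (induction n)
    case 0
    have "F $ 0 = f 0" using has_fps_expansion_imp_0_eq_fps_nth_0[OF F] by simp
    with f(3) show ?case by simp
  next
    case (Suc n)
    let ?c = "real (Suc n) + k * (1 - (-1) ^ Suc n)"
    have c: "?c \<noteq> 0" using dunkl_coeff_denominator_pos[OF k, of n] by linarith
    have "of_real ?c * F $ Suc n = w * F $ n" using rec[of n] by simp
    then have "F $ Suc n = w * F $ n / of_real ?c"
      using c by (metis nonzero_mult_div_cancel_left of_real_eq_0_iff)
    also have "\<dots> = of_real (dunkl_coeff k n / ?c) * w ^ Suc n"
      by (simp only: Suc of_real_divide) simp
    finally show ?case by (simp only: dunkl_coeff.simps)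
  qed
  have "(\<lambda>n. F $ n * z ^ n) sums f z"
    by (rule has_fps_expansion_imp_sums_complex[OF F, of \<infinity>]) (use f(1) in \<open>auto intro: holomorphic_on_subset\<close>)
  moreover have "F $ n * z ^ n = of_real (dunkl_coeff k n) * (w * z) ^ n" for n
    by (simp add: co power_mult_distrib)
  ultimately show ?thesis
    using sums_unique2[OF _ dunkl_series_sums[OF k]] by simp
qed

text \<open>The dilated series is a witness for the definite description, and the recursion for the
  Taylor coefficients gives uniqueness.\<close>

lemma dunkl_kernel_eq_series:
  assumes k: "k > 0"
  shows "dunkl_kernel k z w = dunkl_series k (w * z)"
proof -
  have "(THE f. f holomorphic_on UNIV \<and> (\<forall>u. dunkl_operator k f u = w * f u) \<and> f 0 = 1)
          = (\<lambda>z. dunkl_series k (w * z))"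
  proof (rule the_equality)
    show "(\<lambda>z. dunkl_series k (w * z)) holomorphic_on UNIV \<and>
        (\<forall>u. dunkl_operator k (\<lambda>z. dunkl_series k (w * z)) u = w * dunkl_series k (w * u)) \<and>
        dunkl_series k (w * 0) = 1"
      using holomorphic_on_compose[of "\<lambda>z. w * z" UNIV "dunkl_series k"]
      by (auto simp: dunkl_operator_scale dunkl_operator_series holomorphic_dunkl_series k o_def
          intro!: holomorphic_intros)
  qed (use dunkl_eigenfunction_eq_series[OF k] in blast)
  then show ?thesis unfolding dunkl_kernel_def by simp
qed

lemma dunkl_kernel_real_sums:
  assumes k: "k > 0"
  shows "(\<lambda>n. dunkl_coeff k n * (x * y) ^ n) sums dunkl_kernel_real k x y"
proof -
  have "(\<lambda>n. Re (of_real (dunkl_coeff k n) * (of_real y * of_real x) ^ n)) sums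
          Re (dunkl_series k (of_real y * of_real x))"
    by (rule sums_Re[OF dunkl_series_sums[OF k]])
  then show ?thesis
    by (simp add: dunkl_kernel_real_def dunkl_kernel_eq_series[OF k] mult.commute
        flip: of_real_mult of_real_power)
qed

section \<open>Laplace integral and asymptotics of the Dunkl kernel\<close>

text \<open>The weight is singular at an endpoint if \<open>a < 1\<close> or \<open>b < 1\<close>,
  but it is absolutely integrable, and a bounded measurable factor preserves this.\<close>

lemma continuous_times_beta_integrable:
  fixes g :: "real \<Rightarrow> real"
  assumes "a > 0" "b > 0" "continuous_on {0..1} g"
  shows "(\<lambda>r. g r * (r powr (a - 1) * (1 - r) powr (b - 1))) integrable_on {0..1}"
proof -
  have "(\<lambda>r. r powr (a - 1) * (1 - r) powr (b - 1)) absolutely_integrable_on {0..1}"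
    using has_integral_Beta_real[OF assms(1,2)]
    by (intro nonnegative_absolutely_integrable_1) (auto simp: has_integral_iff)
  moreover have "g \<in> borel_measurable (lebesgue_on {0..1})" "bounded (g ` {0..1})"
    using assms(3)
    by (auto intro: continuous_imp_measurable_on_sets_lebesgue compact_imp_bounded
        compact_continuous_image)
  ultimately show ?thesis
    by (intro set_lebesgue_integral_eq_integral(1)
          absolutely_integrable_bounded_measurable_product_real[of g]) auto
qed

text \<open>With \<open>s = 1 - 2 * r\<close> these are, up to a factor independent of
  \<open>n\<close>, the moments of the Gegenbauer weight \<open>(1 - s ^ 2) powr (k - 1)\<close> on
  the interval from -1 to 1.\<close>

definition sym_moment :: "real \<Rightarrow> nat \<Rightarrow> real" where
  "sym_moment k n =
     integral {0..1} (\<lambda>r. (1 - 2 * r) ^ n * (r powr (k - 1) * (1 - r) powr (k - 1)))"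

lemma has_integral_sym_moment:
  assumes "k > 0"
  shows "((\<lambda>r. (1 - 2 * r) ^ n * (r powr (k - 1) * (1 - r) powr (k - 1))) has_integral
           sym_moment k n) {0..1}"
  unfolding sym_moment_def using assms
  by (intro integrable_integral continuous_times_beta_integrable continuous_intros)

text \<open>The reflection of \<open>r\<close> to \<open>1 - r\<close> fixes the weight and changes
  the sign of odd powers of \<open>1 - 2 * r\<close>.\<close>

lemma sym_moment_odd:
  assumes k: "k > 0" and n: "odd n"
  shows "sym_moment k n = 0"
proof -
  let ?f = "\<lambda>r::real. (1 - 2 * r) ^ n * (r powr (k - 1) * (1 - r) powr (k - 1))"
  have "((\<lambda>r. ?f (-1 *\<^sub>R r + 1)) has_integral 1 *\<^sub>R sym_moment k n) {0..1}"
    using has_integral_affinity[of ?f "sym_moment k n" 0 1 "-1" 1] has_integral_sym_moment[OF k, of n]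
    by simp
  moreover have "?f (-1 *\<^sub>R r + 1) = - ?f r" for r
  proof -
    have e: "1 - 2 * (-1 *\<^sub>R r + 1) = - (1 - 2 * r)" "1 - (-1 *\<^sub>R r + 1) = r" "-1 *\<^sub>R r + 1 = 1 - r"
      by simp_all
    show ?thesis
      unfolding e(1,2) unfolding e(3) power_minus_odd[OF n] by simp
  qed
  ultimately have "((\<lambda>r. - ?f r) has_integral sym_moment k n) {0..1}"
    by (simp only: scaleR_one)
  then have "sym_moment k n = - sym_moment k n"
    using has_integral_neg[OF has_integral_sym_moment[OF k, of n]] by (rule has_integral_unique)
  then show ?thesis by simp
qed

text \<open>Integration by parts: the derivative of \<open>(1 - 2 r) ^ (n + 1) * (r (1 - r)) powr k\<close>
  integrates to zero.\<close>

lemma sym_moment_rec: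
  assumes k: "k > 0"
  shows "(real (Suc n) + 2 * k) * sym_moment k (Suc (Suc n)) = real (Suc n) * sym_moment k n"
proof -
  let ?v = "\<lambda>r::real. r powr (k - 1) * (1 - r) powr (k - 1)"
  let ?G = "\<lambda>r::real. (1 - 2 * r) ^ Suc n * (r powr k * (1 - r) powr k)"
  \<comment> \<open>The derivative of \<open>?G\<close>, rewritten with
    \<open>r * (1 - r) = (1 - (1 - 2 * r) ^ 2) / 4\<close> so that only integrands of
    \<open>sym_moment\<close> remain.\<close>
  let ?g = "\<lambda>r::real. (real (Suc n) / 2 + k) * ((1 - 2 * r) ^ Suc (Suc n) * ?v r)
               - real (Suc n) / 2 * ((1 - 2 * r) ^ n * ?v r)"
  \<comment> \<open>For \<open>k < 1\<close> the powers are not differentiable at the endpoints;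
    continuity there suffices.\<close>
  have "(?g has_integral ?G 1 - ?G 0) {0..1}"
  proof (rule fundamental_theorem_of_calculus_interior)
    show "continuous_on {0..1} ?G"
      using k by (intro continuous_intros continuous_on_powr') auto
    fix r :: real assume r: "r \<in> {0<..<1}"
    have p: "r powr k = r * r powr (k - 1)" "(1 - r) powr k = (1 - r) * (1 - r) powr (k - 1)"
      using r by (simp_all add: powr_diff)
    have "(?G has_real_derivative
            real (Suc n) * (1 - 2 * r) ^ n * (-2) * (r powr k * (1 - r) powr k) +
            (1 - 2 * r) ^ Suc n * (k * r powr (k - 1) * (1 - r) powr k
               - r powr k * (k * (1 - r) powr (k - 1)))) (at r)"
      using r by (auto intro!: derivative_eq_intros simp del: power_Suc)
    also have "real (Suc n) * (1 - 2 * r) ^ n * (-2) * (r powr k * (1 - r) powr k) +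
            (1 - 2 * r) ^ Suc n * (k * r powr (k - 1) * (1 - r) powr k
               - r powr k * (k * (1 - r) powr (k - 1))) = ?g r"
      unfolding p by (simp add: field_simps)
    finally show "(?G has_vector_derivative ?g r) (at r)"
      by (simp add: has_real_derivative_iff_has_vector_derivative)
  qed simp
  moreover have "(?g has_integral (real (Suc n) / 2 + k) * sym_moment k (Suc (Suc n))
                   - real (Suc n) / 2 * sym_moment k n) {0..1}"
    by (intro has_integral_diff has_integral_mult_right has_integral_sym_moment k)
  ultimately have "(real (Suc n) / 2 + k) * sym_moment k (Suc (Suc n))
                     - real (Suc n) / 2 * sym_moment k n = ?G 1 - ?G 0"
    by (rule has_integral_unique[rotated])
  then show ?thesis by (simp add: field_simps)
qed

text \<open>The identity \<open>1 - r = (1 + (1 - 2 * r)) / 2\<close> reduces the asymmetric weight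
  to the symmetric one.\<close>

lemma has_integral_dunkl_moment_sym:
  assumes k: "k > 0"
  shows "((\<lambda>r. (1 - 2 * r) ^ n * (r powr (k - 1) * (1 - r) powr k)) has_integral
           (sym_moment k n + sym_moment k (Suc n)) / 2) {0..1}"
proof -
  let ?v = "\<lambda>r::real. r powr (k - 1) * (1 - r) powr (k - 1)"
  have "((\<lambda>r. ((1 - 2 * r) ^ n * ?v r + (1 - 2 * r) ^ Suc n * ?v r) / 2) has_integral
          (sym_moment k n + sym_moment k (Suc n)) / 2) {0..1}"
    by (intro has_integral_divide has_integral_add has_integral_sym_moment k)
  then show ?thesis
  proof (rule has_integral_eq[rotated])
    fix r :: real assume "r \<in> {0..1}"
    then have "(1 - r) powr k = (1 - r) * (1 - r) powr (k - 1)"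
      by (cases "r = 1") (simp_all add: powr_diff)
    then show "((1 - 2 * r) ^ n * ?v r + (1 - 2 * r) ^ Suc n * ?v r) / 2
                 = (1 - 2 * r) ^ n * (r powr (k - 1) * (1 - r) powr k)"
      by (simp only:) (simp add: field_simps)
  qed
qed

text \<open>Divided by \<open>fact n\<close>, the moments obey the recursion of the coefficients;
  the Beta constant is the moment of order zero.\<close>

lemma has_integral_dunkl_moment:
  assumes k: "k > 0"
  shows "((\<lambda>r. (1 - 2 * r) ^ n * (r powr (k - 1) * (1 - r) powr k)) has_integral
           Beta k (k + 1) * fact n * dunkl_coeff k n) {0..1}"
proof -
  define m where "m n = (sym_moment k n + sym_moment k (Suc n)) / 2" for n
  have m: "((\<lambda>r. (1 - 2 * r) ^ n * (r powr (k - 1) * (1 - r) powr k)) has_integral m n) {0..1}" for n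
    unfolding m_def by (rule has_integral_dunkl_moment_sym[OF k])
  have "m n = Beta k (k + 1) * fact n * dunkl_coeff k n"
  proof (induction n)
    case 0
    have "((\<lambda>r. r powr (k - 1) * (1 - r) powr k) has_integral Beta k (k + 1)) {0..1}"
      using has_integral_Beta_real[of k "k + 1"] k by simp
    with m[of 0] show ?case by (simp add: has_integral_unique)
  next
    case (Suc n)
    let ?c = "real (Suc n) + k * (1 - (-1) ^ Suc n)"
    have c: "?c > 0" by (rule dunkl_coeff_denominator_pos[OF k])
    \<comment> \<open>For even \<open>n\<close> this is the two-step recursion of the symmetric
      moments. For odd \<open>n\<close> the denominator is \<open>Suc n\<close>, and both moments
      equal half of \<open>sym_moment k (Suc n)\<close>.\<close>
    have "?c * m (Suc n) = real (Suc n) * m n"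
    proof (cases "even n")
      case True
      with sym_moment_rec[OF k, of n] show ?thesis
        by (simp add: m_def sym_moment_odd[OF k] mult.commute)
    next
      case False
      then show ?thesis by (simp add: m_def sym_moment_odd[OF k])
    qed
    then have "m (Suc n) = real (Suc n) * m n / ?c" using c by (simp add: field_simps)
    also have "\<dots> = Beta k (k + 1) * fact (Suc n) * (dunkl_coeff k n / ?c)"
      by (simp add: Suc)
    finally show ?case by (simp only: dunkl_coeff.simps)
  qed
  with m[of n] show ?thesis by (simp only:)
qed

section \<open>Laplace integral of the kernel\<close>

text \<open>The exponential series is integrated term by term; its denominators cancel the
  \<open>fact n\<close> in the moments.\<close>

lemma has_integral_dunkl_kernel:
  assumes k: "k > 0"
  shows "((\<lambda>r. exp (x * y * (1 - 2 * r)) * (r powr (k - 1) * (1 - r) powr k)) has_integral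
           Beta k (k + 1) * dunkl_kernel_real k x y) {0..1}"
proof -
  let ?w = "\<lambda>r::real. r powr (k - 1) * (1 - r) powr k"
  define u where "u = x * y"
  define S where "S N r = (\<Sum>n<N. u ^ n / fact n * ((1 - 2 * r) ^ n * ?w r))" for N r
  have S: "(S N has_integral (\<Sum>n<N. u ^ n / fact n * (Beta k (k + 1) * fact n * dunkl_coeff k n))) {0..1}"
    for N unfolding S_def[abs_def]
    by (intro has_integral_sum has_integral_mult_right has_integral_dunkl_moment k) simp
  have S_exp: "S N r = (\<Sum>n<N. (u * (1 - 2 * r)) ^ n /\<^sub>R fact n) * ?w r" for N r
    unfolding S_def power_mult_distrib sum_distrib_right by (simp add: field_simps)
  \<comment> \<open>Since \<open>\<bar>1 - 2 * r\<bar> \<le> 1\<close>, one multiple of the Beta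
    weight bounds all partial sums.\<close>
  have dom: "norm (S N r) \<le> exp \<bar>u\<bar> * ?w r" if "r \<in> {0..1}" for N r
  proof -
    have "norm (\<Sum>n<N. (u * (1 - 2 * r)) ^ n /\<^sub>R fact n) \<le> (\<Sum>n<N. \<bar>u\<bar> ^ n /\<^sub>R fact n)"
      using that by (intro sum_norm_le)
        (auto simp: abs_mult power_abs divide_simps power_mult_distrib
          intro!: mult_left_le power_le_one)
    also have "\<dots> \<le> exp \<bar>u\<bar>"
      unfolding exp_def using summable_exp_generic[of "\<bar>u\<bar>"] by (intro sum_le_suminf) auto
    finally show ?thesis
      by (simp add: S_exp abs_mult mult_right_mono)
  qed
  have w: "(\<lambda>r. exp \<bar>u\<bar> * ?w r) integrable_on {0..1}"
    using has_integral_integrable[OF has_integral_mult_right[OF has_integral_Beta_real[of k "k + 1"]]] k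
    by simp
  have lim: "(\<lambda>N. S N r) \<longlonglongrightarrow> exp (u * (1 - 2 * r)) * ?w r" for r
    unfolding S_exp by (intro tendsto_mult tendsto_const exp_converges[unfolded sums_def])
  have int: "(\<lambda>r. exp (u * (1 - 2 * r)) * ?w r) integrable_on {0..1}"
    and conv: "(\<lambda>N. integral {0..1} (S N)) \<longlonglongrightarrow> integral {0..1} (\<lambda>r. exp (u * (1 - 2 * r)) * ?w r)"
    using dominated_convergence[OF has_integral_integrable[OF S] w dom lim] by auto
  have "(\<lambda>n. Beta k (k + 1) * (dunkl_coeff k n * (x * y) ^ n)) sums
          (Beta k (k + 1) * dunkl_kernel_real k x y)"
    by (intro sums_mult dunkl_kernel_real_sums k)
  then have "(\<lambda>N. integral {0..1} (S N)) \<longlonglongrightarrow> Beta k (k + 1) * dunkl_kernel_real k x y"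
    by (simp add: integral_unique[OF S] sums_def u_def mult_ac)
  with conv int show ?thesis
    unfolding has_integral_iff u_def using LIMSEQ_unique by blast
qed

section \<open>Scaling and behaviour at infinity\<close>

text \<open>Substituting \<open>q = 2 * u * r\<close> magnifies the endpoint \<open>r = 0\<close>,
  where the exponential is largest; the integrand then approaches that of \<open>Gamma k\<close> for
  large \<open>u\<close>. Extension by zero gives all \<open>u\<close> a common domain.\<close>

lemma has_integral_scaled_dunkl_kernel:
  assumes k: "k > 0" and u: "u > 0"
  shows "((\<lambda>q. if q \<in> {0..2 * u} then q powr (k - 1) / exp q * (1 - q / (2 * u)) powr k else 0)
           has_integral
           Beta k (k + 1) * 2 powr k * (u powr k * exp (- u) * dunkl_kernel_real k u 1)) {0..}"
proof -
  let ?w = "\<lambda>r::real. r powr (k - 1) * (1 - r) powr k"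
  let ?I = "Beta k (k + 1) * 2 powr k * (u powr k * exp (- u) * dunkl_kernel_real k u 1)"
  have "((\<lambda>r. exp (- u) * (2 * u) powr (k - 1) * (exp (u * 1 * (1 - 2 * r)) * ?w r)) has_integral
          exp (- u) * (2 * u) powr (k - 1) * (Beta k (k + 1) * dunkl_kernel_real k u 1)) {0..1}"
    by (intro has_integral_mult_right has_integral_dunkl_kernel k)
  from has_integral_stretch_real[OF this, of "1 / (2 * u)"]
  have "((\<lambda>q. exp (- u) * (2 * u) powr (k - 1) * (exp (u * 1 * (1 - 2 * (1 / (2 * u) * q))) * ?w (1 / (2 * u) * q)))
          has_integral 2 * u * (exp (- u) * (2 * u) powr (k - 1) * (Beta k (k + 1) * dunkl_kernel_real k u 1)))
          ((\<lambda>q. q / (1 / (2 * u))) ` {0..1})"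
    using u by (simp add: mult_ac)
  also have "(\<lambda>q. q / (1 / (2 * u))) ` {0..1} = {0..2 * u}"
    using u image_mult_atLeastAtMost[of "2 * u" 0 1] by (simp add: mult.commute)
  also have "2 * u * (exp (- u) * (2 * u) powr (k - 1) * (Beta k (k + 1) * dunkl_kernel_real k u 1)) = ?I"
    using u by (simp add: powr_diff powr_mult)
  finally have "((\<lambda>q. q powr (k - 1) / exp q * (1 - q / (2 * u)) powr k) has_integral ?I) {0..2 * u}"
  proof (rule has_integral_eq[rotated])
    fix q assume "q \<in> {0..2 * u}"
    then have p: "(2 * u) powr (k - 1) * (1 / (2 * u) * q) powr (k - 1) = q powr (k - 1)"
      using u by (subst powr_mult[symmetric]) auto
    have e: "exp (- u) * exp (u * 1 * (1 - 2 * (1 / (2 * u) * q))) = 1 / exp q"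
    proof -
      have "u * 1 * (1 - 2 * (1 / (2 * u) * q)) = u - q" using u by (simp add: field_simps)
      then show ?thesis by (simp add: exp_diff exp_minus)
    qed
    have "exp (- u) * (2 * u) powr (k - 1) * (exp (u * 1 * (1 - 2 * (1 / (2 * u) * q))) * ?w (1 / (2 * u) * q))
            = (exp (- u) * exp (u * 1 * (1 - 2 * (1 / (2 * u) * q))))
              * ((2 * u) powr (k - 1) * (1 / (2 * u) * q) powr (k - 1)) * (1 - 1 / (2 * u) * q) powr k"
      by (simp only: mult_ac)
    also have "\<dots> = q powr (k - 1) / exp q * (1 - q / (2 * u)) powr k"
      unfolding p e by simp
    finally show "exp (- u) * (2 * u) powr (k - 1) * (exp (u * 1 * (1 - 2 * (1 / (2 * u) * q))) * ?w (1 / (2 * u) * q))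
            = q powr (k - 1) / exp q * (1 - q / (2 * u)) powr k" .
  qed
  then show ?thesis
    by (subst has_integral_restrict) auto
qed

text \<open>Legendre duplication rewrites the \<open>Gamma (2 * k)\<close> hidden in the Beta value,
  so that the limit constant matches the normalisation of the transition density.\<close>

lemma Beta_k_Suc_k:
  assumes "k > (0 :: real)"
  shows "Gamma k / (Beta k (k + 1) * 2 powr k) = 2 powr k * Gamma (k + 1 / 2) / sqrt pi"
proof -
  have nz: "complex_of_real x \<notin> \<int>\<^sub>\<le>\<^sub>0" if "x > 0" for x
  proof
    assume "complex_of_real x \<in> \<int>\<^sub>\<le>\<^sub>0"
    then obtain n where "complex_of_real x = of_int n" "n \<le> 0" by (elim nonpos_Ints_cases)
    then have "x = of_int n" by (metis of_real_of_int_eq of_real_eq_iff)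
    with \<open>n \<le> 0\<close> that show False by simp
  qed
  have "Gamma (complex_of_real k) * Gamma (complex_of_real k + 1 / 2) =
          exp ((1 - 2 * complex_of_real k) * of_real (ln 2)) * of_real (sqrt pi) * Gamma (2 * complex_of_real k)"
    using nz[of k] nz[of "k + 1/2"] assms by (intro Gamma_legendre_duplication) auto
  moreover have "exp ((1 - 2 * complex_of_real k) * of_real (ln 2)) = of_real (2 powr (1 - 2 * k))"
    by (simp add: powr_def flip: exp_of_real)
  ultimately have "complex_of_real (Gamma k * Gamma (k + 1 / 2)) =
      complex_of_real (2 powr (1 - 2 * k) * sqrt pi * Gamma (2 * k))"
    using Gamma_complex_of_real[of "k + 1/2"] Gamma_complex_of_real[of "2 * k"] Gamma_complex_of_real[of k]
    by simp
  then have dup: "Gamma k * Gamma (k + 1 / 2) = 2 powr (1 - 2 * k) * sqrt pi * Gamma (2 * k)"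
    by (simp only: of_real_eq_iff)
  have pos: "Gamma k > 0" "Gamma (2 * k) > 0" "Gamma (k + 1/2) > 0" using assms by auto
  have "Gamma (k + 1) = k * Gamma k" "Gamma (2 * k + 1) = 2 * k * Gamma (2 * k)"
    using assms Gamma_plus1[of k] Gamma_plus1[of "2 * k"]
    by (force elim!: nonpos_Ints_cases)+
  then have B: "Beta k (k + 1) = Gamma k * Gamma k / (2 * Gamma (2 * k))"
    using assms by (simp add: Beta_def field_simps)
  have p: "(2 :: real) powr (1 - 2 * k) = 2 / (2 powr k * 2 powr k)"
    by (simp add: powr_diff flip: powr_add)
  have G: "Gamma (2 * k) = Gamma k * Gamma (k + 1 / 2) * (2 powr k * 2 powr k) / (2 * sqrt pi)"
    using dup unfolding p by (simp add: field_simps)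
  have "Gamma k / (Beta k (k + 1) * 2 powr k) = 2 * Gamma (2 * k) / (2 powr k * Gamma k)"
    unfolding B using pos by (simp add: field_simps)
  also have "\<dots> = 2 powr k * Gamma (k + 1 / 2) / sqrt pi"
    unfolding G using pos by simp
  finally show ?thesis .
qed

text \<open>Only the mass of the integral representation near \<open>r = 0\<close> survives (Watson's lemma).\<close>

lemma dunkl_kernel_asymptotics:
  assumes k: "k > 0"
  shows "((\<lambda>u. u powr k * exp (- u) * dunkl_kernel_real k u 1) \<longlongrightarrow>
           2 powr k * Gamma (k + 1 / 2) / sqrt pi) at_top"
proof -
  define h where "h u q = (if q \<in> {0..2 * u} then q powr (k - 1) / exp q * (1 - q / (2 * u)) powr k else 0)"
    for u q :: real
  have "((\<lambda>u. integral {0..} (h u)) \<longlongrightarrow> Gamma k) at_top"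
  proof (rule tendsto_at_topI_sequentially)
    fix U :: "nat \<Rightarrow> real" assume U: "filterlim U at_top sequentially"
    \<comment> \<open>Dominated convergence asks for integrability at every index, so the sequence
      is made positive; this changes only finitely many terms.\<close>
    define V where "V n = max 1 (U n)" for n
    have V: "V n > 0" for n by (simp add: V_def)
    have ev: "eventually (\<lambda>n. V n = U n) sequentially"
      using filterlim_at_top[THEN iffD1, OF U, rule_format, of 1]
      by eventually_elim (simp add: V_def)
    have Vtop: "filterlim V at_top sequentially"
      using filterlim_cong[OF refl refl ev] U by simp
    have "(\<lambda>n. integral {0..} (h (V n))) \<longlonglongrightarrow> integral {0..} (\<lambda>q. q powr (k - 1) / exp q)"
    proof (rule dominated_convergence(2))
      show "h (V n) integrable_on {0..}" for n
        using has_integral_scaled_dunkl_kernel[OF k V] unfolding h_def[abs_def] by blast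
      show "(\<lambda>q. q powr (k - 1) / exp q) integrable_on {0..}"
        using Gamma_integral_real[OF k] by blast
      \<comment> \<open>On the support \<open>1 - q / (2 * V n)\<close> lies between 0 and 1, so the
        Gamma integrand itself dominates.\<close>
      show "norm (h (V n) q) \<le> q powr (k - 1) / exp q" if "q \<in> {0..}" for n q
        using V[of n] k by (auto simp: h_def abs_mult divide_simps intro!: mult_left_le powr_le1)
      show "(\<lambda>n. h (V n) q) \<longlonglongrightarrow> q powr (k - 1) / exp q" if q: "q \<in> {0..}" for q
      proof -
        have "eventually (\<lambda>n. V n \<ge> q + 1) sequentially"
          using Vtop by (simp add: filterlim_at_top)
        then have "eventually (\<lambda>n. h (V n) q = q powr (k - 1) / exp q * (1 - q / (2 * V n)) powr k) sequentially"
          by eventually_elim (use q in \<open>auto simp: h_def\<close>)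
        moreover have "(\<lambda>n. q powr (k - 1) / exp q * (1 - q / (2 * V n)) powr k) \<longlonglongrightarrow>
            q powr (k - 1) / exp q * (1 - 0) powr k"
          using Vtop by (intro tendsto_intros tendsto_divide_0[OF tendsto_const]
              filterlim_at_top_imp_at_infinity filterlim_tendsto_pos_mult_at_top[OF tendsto_const]) auto
        ultimately show ?thesis by (simp add: tendsto_cong)
      qed
    qed
    then have "(\<lambda>n. integral {0..} (h (V n))) \<longlonglongrightarrow> Gamma k"
      by (simp add: integral_unique[OF Gamma_integral_real[OF k]])
    then show "(\<lambda>n. integral {0..} (h (U n))) \<longlonglongrightarrow> Gamma k"
      by (rule Lim_transform_eventually) (use ev in eventually_elim, simp)
  qed
  moreover have "eventually (\<lambda>u. integral {0..} (h u) =
      Beta k (k + 1) * 2 powr k * (u powr k * exp (- u) * dunkl_kernel_real k u 1)) at_top"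
    using eventually_gt_at_top[of 0]
    by eventually_elim
      (use integral_unique[OF has_integral_scaled_dunkl_kernel[OF k]] in \<open>simp add: h_def[abs_def]\<close>)
  ultimately have "((\<lambda>u. Beta k (k + 1) * 2 powr k * (u powr k * exp (- u) * dunkl_kernel_real k u 1)) \<longlongrightarrow> Gamma k) at_top"
    by (simp add: tendsto_cong)
  then have "((\<lambda>u. Beta k (k + 1) * 2 powr k * (u powr k * exp (- u) * dunkl_kernel_real k u 1)
                / (Beta k (k + 1) * 2 powr k)) \<longlongrightarrow> Gamma k / (Beta k (k + 1) * 2 powr k)) at_top"
    using k by (intro tendsto_divide tendsto_const) (auto simp: Beta_def Gamma_eq_zero_iff elim!: nonpos_Ints_cases)
  moreover have "Beta k (k + 1) * 2 powr k \<noteq> 0"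
    using k by (auto simp: Beta_def Gamma_eq_zero_iff elim!: nonpos_Ints_cases)
  ultimately show ?thesis
    by (simp add: Beta_k_Suc_k[OF k] mult.assoc)
qed

section \<open>Convergence of the rescaled process\<close>

text \<open>Integrating the Markov property at time \<open>0\<close> removes the conditional
  expectation, and the almost surely constant start makes the right-hand side constant.\<close>

lemma markov_process_distr:
  assumes mp: "markov_process M X K" and t: "t \<ge> 0"
    and x0: "AE \<omega> in M. X 0 \<omega> = x0" and A: "A \<in> sets borel"
  shows "measure M (X t -` A \<inter> space M) = measure (K t x0) A"
proof -
  interpret prob_space M using mp by (simp add: markov_process_def)
  have X: "X s \<in> borel_measurable M" if "s \<ge> 0" for s
    using mp that by (simp add: markov_process_def)
  let ?F = "natural_filtration M X 0" and ?B = "X t -` A \<inter> space M"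
  have B: "?B \<in> sets M" using measurable_sets[OF X[OF t] A] .
  have sub: "subalgebra M ?F"
    unfolding subalgebra_def natural_filtration_def
    using measurable_sets[OF X]
    by (auto intro!: sets.sigma_sets_subset simp: space_measure_of_conv sets_measure_of_conv)
  interpret F: finite_measure_subalgebra M ?F
    by unfold_locales (rule sub)
  have "measure M ?B = (\<integral>\<omega>. indicator ?B \<omega> \<partial>M)" using B by simp
  also have "\<dots> = (\<integral>\<omega>. real_cond_exp M ?F (indicator ?B) \<omega> \<partial>M)"
    using B by (intro F.real_cond_exp_int(2)[symmetric]) (auto simp: emeasure_eq_measure)
  also have "\<dots> = (\<integral>\<omega>. measure (K t x0) A \<partial>M)"
  proof (rule integral_cong_AE)
    have "AE \<omega> in M. real_cond_exp M ?F (indicator (X (0 + t) -` A \<inter> space M)) \<omega> =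
            measure (K t (X 0 \<omega>)) A"
      using mp t A unfolding markov_process_def by blast
    then show "AE \<omega> in M. real_cond_exp M ?F (indicator ?B) \<omega> = measure (K t x0) A"
      using x0 by eventually_elim simp
  qed (simp_all add: borel_measurable_cond_exp2)
  finally show ?thesis by (simp add: prob_space)
qed

section \<open>Transition density from the origin and its rescaled limit\<close>

lemma continuous_on_dunkl_kernel_real:
  assumes "k > 0"
  shows "continuous_on A (\<lambda>y. dunkl_kernel_real k y l)"
proof -
  have "continuous_on UNIV (dunkl_series k)"
    by (intro holomorphic_on_imp_continuous_on holomorphic_dunkl_series assms)
  then show ?thesis
    unfolding dunkl_kernel_real_def dunkl_kernel_eq_series[OF assms]
    by (intro continuous_intros continuous_on_compose2[of UNIV "dunkl_series k" A]) auto
qed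

lemma dunkl_kernel_real_0 [simp]: "k > 0 \<Longrightarrow> dunkl_kernel_real k 0 y = 1"
  by (simp add: dunkl_kernel_real_def dunkl_kernel_eq_series)

text \<open>Dependence on the product alone lets the drift be absorbed into the single variable
  \<open>u = y * l\<close>.\<close>

lemma dunkl_kernel_real_mult: "k > 0 \<Longrightarrow> dunkl_kernel_real k (x * y) 1 = dunkl_kernel_real k x y"
  by (simp add: dunkl_kernel_real_def dunkl_kernel_eq_series mult.commute)

lemma dunkl_transition_density_0:
  assumes "k > 0"
  shows "dunkl_transition_density k l t 0 y =
     exp (- l\<^sup>2 * t / 2) / (2 powr (k + 1/2) * Gamma (k + 1/2) * t powr (k + 1/2)) *
     (exp (- y\<^sup>2 / (2 * t)) * dunkl_kernel_real k y l * \<bar>y\<bar> powr (2 * k))"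
  using assms by (simp add: dunkl_transition_density_def)

lemma borel_measurable_dunkl_transition_density_0 [measurable]:
  assumes "k > 0"
  shows "dunkl_transition_density k l t 0 \<in> borel_measurable borel"
  using borel_measurable_continuous_onI[OF continuous_on_dunkl_kernel_real[OF assms, of UNIV l]]
  unfolding dunkl_transition_density_0[OF assms, abs_def] by measurable

text \<open>Expanding the square merges the drift factor and the Gaussian into
  \<open>exp (- u) * exp (- z\<^sup>2 / 2)\<close>. Of the two powers \<open>u powr k\<close>, one
  joins the kernel asymptotics and the other is compared with \<open>l\<^sup>2 * t\<close>.\<close>

lemma rescaled_dunkl_density:
  assumes k: "k > 0" and t: "t > 0" and l: "l \<noteq> 0" and y: "y = t * l + sqrt t * z"
    and u: "u = y * l" "u > 0"
  shows "sqrt t * dunkl_transition_density k l t 0 y =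
    (u powr k * exp (- u) * dunkl_kernel_real k u 1) * (u / (l\<^sup>2 * t)) powr k * exp (- z\<^sup>2 / 2)
      / (2 powr (k + 1/2) * Gamma (k + 1/2))"
proof -
  \<comment> \<open>Positivity gives \<open>u = \<bar>y\<bar> * \<bar>l\<bar>\<close>, which covers
    both signs of the drift.\<close>
  have abs_y: "\<bar>y\<bar> = u / \<bar>l\<bar>"
    using u l by (metis abs_mult abs_of_pos nonzero_mult_div_cancel_right abs_eq_0)
  have "\<bar>y\<bar> powr (2 * k) = u powr (2 * k) / \<bar>l\<bar> powr (2 * k)"
    using u by (simp add: abs_y powr_divide)
  also have "\<bar>l\<bar> powr (2 * k) = (l\<^sup>2) powr k"
    using l powr_powr[of "\<bar>l\<bar>" 2 k] by (simp add: powr_numeral)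
  also have "u powr (2 * k) = u powr k * u powr k"
    by (simp flip: powr_add)
  finally have 1: "\<bar>y\<bar> powr (2 * k) = u powr k * u powr k / (l\<^sup>2) powr k" .
  have "y\<^sup>2 / (2 * t) = t * l\<^sup>2 / 2 + sqrt t * z * l + z\<^sup>2 / 2"
    using t by (simp add: y power2_sum power_mult_distrib field_simps power2_eq_square)
  moreover have "- l\<^sup>2 * t / 2 + - y\<^sup>2 / (2 * t) = - (l\<^sup>2 * t / 2) - y\<^sup>2 / (2 * t)"
    by simp
  ultimately have "- l\<^sup>2 * t / 2 + - y\<^sup>2 / (2 * t) = - u + - z\<^sup>2 / 2"
    by (simp add: u(1) y algebra_simps power2_eq_square)
  then have 2: "exp (- l\<^sup>2 * t / 2) * exp (- y\<^sup>2 / (2 * t)) = exp (- u) * exp (- z\<^sup>2 / 2)"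
    by (simp only: exp_add[symmetric])
  have 3: "t powr (k + 1/2) = t powr k * sqrt t"
    using t by (simp add: powr_add powr_half_sqrt)
  have 4: "(u / (l\<^sup>2 * t)) powr k = u powr k / ((l\<^sup>2) powr k * t powr k)"
    using u t by (simp add: powr_divide powr_mult)
  have "sqrt t * dunkl_transition_density k l t 0 y =
     (exp (- l\<^sup>2 * t / 2) * exp (- y\<^sup>2 / (2 * t))) * dunkl_kernel_real k u 1 * (\<bar>y\<bar> powr (2 * k))
       * sqrt t / (2 powr (k + 1/2) * Gamma (k + 1/2) * t powr (k + 1/2))"
    unfolding dunkl_transition_density_0[OF k] u(1) dunkl_kernel_real_mult[OF k]
    by (simp only: times_divide_eq_left times_divide_eq_right mult_ac)
  also have "\<dots> = (exp (- u) * exp (- z\<^sup>2 / 2)) * dunkl_kernel_real k u 1 * (u powr k * u powr k / (l\<^sup>2) powr k)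
       * sqrt t / (2 powr (k + 1/2) * Gamma (k + 1/2) * (t powr k * sqrt t))"
    unfolding 1 2 3 ..
  also have "\<dots> = (u powr k * exp (- u) * dunkl_kernel_real k u 1) * (u / (l\<^sup>2 * t)) powr k * exp (- z\<^sup>2 / 2)
      / (2 powr (k + 1/2) * Gamma (k + 1/2))"
    unfolding 4 using t by (simp add: mult_ac)
  finally show ?thesis .
qed

lemma rescaled_dunkl_density_tendsto:
  assumes k: "k > 0" and l: "l \<noteq> 0"
  shows "((\<lambda>t. sqrt t * dunkl_transition_density k l t 0 (t * l + sqrt t * z)) \<longlongrightarrow>
           std_normal_density z) at_top"
proof -
  define u where "u t = (t * l + sqrt t * z) * l" for t
  \<comment> \<open>This is \<open>u t\<close> divided by its leading term
    \<open>l\<^sup>2 * t\<close>; the correction vanishes whatever the signs of \<open>l\<close> and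
    \<open>z\<close>.\<close>
  have r: "((\<lambda>t. 1 + z / (l * sqrt t)) \<longlongrightarrow> 1 + 0) at_top"
    using l by (intro tendsto_intros tendsto_divide_0[OF tendsto_const] tendsto_mult_filterlim_at_infinity
        filterlim_at_top_imp_at_infinity sqrt_at_top) auto
  have ur: "eventually (\<lambda>t. u t / (l\<^sup>2 * t) = 1 + z / (l * sqrt t)) at_top"
    using eventually_gt_at_top[of 0]
  proof eventually_elim
    case (elim t)
    have "t = sqrt t * sqrt t" using elim by simp
    then have "u t / (l\<^sup>2 * t) = (sqrt t * sqrt t * l + sqrt t * z) * l / (l\<^sup>2 * (sqrt t * sqrt t))"
      unfolding u_def by presburger
    also have "\<dots> = 1 + z / (l * sqrt t)"
      using l elim by (simp add: field_simps power2_eq_square del: real_sqrt_mult_self)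
    finally show ?case .
  qed
  have r': "((\<lambda>t. u t / (l\<^sup>2 * t)) \<longlongrightarrow> 1) at_top"
    using r ur by (simp add: tendsto_cong)
  have "filterlim (\<lambda>t. (u t / (l\<^sup>2 * t)) * (l\<^sup>2 * t)) at_top at_top"
    using l by (intro filterlim_tendsto_pos_mult_at_top[OF r'] filterlim_tendsto_pos_mult_at_top[OF tendsto_const]
        filterlim_ident) auto
  moreover have "eventually (\<lambda>t. (u t / (l\<^sup>2 * t)) * (l\<^sup>2 * t) = u t) at_top"
    using eventually_gt_at_top[of 0] by eventually_elim (use l in simp)
  ultimately have u_top: "filterlim u at_top at_top"
    by (simp add: filterlim_cong)
  have Gpos: "Gamma (k + 1/2) > 0" using k by simp
  have "((\<lambda>t. (u t powr k * exp (- u t) * dunkl_kernel_real k (u t) 1) * (u t / (l\<^sup>2 * t)) powr k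
           * exp (- z\<^sup>2 / 2) / (2 powr (k + 1/2) * Gamma (k + 1/2))) \<longlongrightarrow>
        2 powr k * Gamma (k + 1 / 2) / sqrt pi * 1 powr k * exp (- z\<^sup>2 / 2) / (2 powr (k + 1/2) * Gamma (k + 1/2))) at_top"
    using Gpos
    by (intro tendsto_intros filterlim_compose[OF dunkl_kernel_asymptotics[OF k] u_top] r') auto
  \<comment> \<open>The Gamma factors cancel, and
    \<open>2 powr k / (sqrt pi * 2 powr (k + 1/2))\<close> is
    \<open>1 / sqrt (2 * pi)\<close>.\<close>
  also have "2 powr k * Gamma (k + 1 / 2) / sqrt pi * 1 powr k * exp (- z\<^sup>2 / 2) / (2 powr (k + 1/2) * Gamma (k + 1/2))
      = std_normal_density z"
    using Gpos
    by (simp add: normal_density_def powr_add powr_half_sqrt real_sqrt_mult)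
  finally show ?thesis
  proof (rule Lim_transform_eventually)
    show "eventually (\<lambda>t. (u t powr k * exp (- u t) * dunkl_kernel_real k (u t) 1) * (u t / (l\<^sup>2 * t)) powr k
           * exp (- z\<^sup>2 / 2) / (2 powr (k + 1/2) * Gamma (k + 1/2))
         = sqrt t * dunkl_transition_density k l t 0 (t * l + sqrt t * z)) at_top"
      using eventually_gt_at_top[of 0] filterlim_at_top_dense[THEN iffD1, OF u_top, rule_format, of 0]
      by eventually_elim (rule rescaled_dunkl_density[OF k _ l refl, symmetric], simp_all add: u_def)
  qed
qed

section \<open>From densities to distribution functions\<close>

text \<open>Equal total masses turn pointwise convergence of densities into L1 convergence, which
  controls the measure of each set.\<close>

lemma tendsto_measure_density_Scheffe:
  fixes f :: "real \<Rightarrow> 'a \<Rightarrow> real"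
  assumes f: "\<And>t. t > 0 \<Longrightarrow> f t \<in> borel_measurable M" "\<And>t. t > 0 \<Longrightarrow> prob_space (density M (f t))"
    and g: "g \<in> borel_measurable M" "\<And>x. g x \<ge> 0" "prob_space (density M g)"
    and lim: "\<And>x. ((\<lambda>t. f t x) \<longlongrightarrow> g x) at_top"
    and A: "A \<in> sets M"
  shows "((\<lambda>t. measure (density M (f t)) A) \<longlongrightarrow> measure (density M g) A) at_top"
proof (rule tendsto_at_topI_sequentially)
  fix T :: "nat \<Rightarrow> real" assume T: "filterlim T at_top sequentially"
  \<comment> \<open>The maximum keeps every index in the range \<open>t > 0\<close> where the
    assumptions hold.\<close>
  define S where "S n = max 1 (T n)" for n
  have S: "S n > 0" for n by (simp add: S_def)
  have ev: "eventually (\<lambda>n. S n = T n) sequentially"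
    using filterlim_at_top[THEN iffD1, OF T, rule_format, of 1]
    by eventually_elim (simp add: S_def)
  have Stop: "filterlim S at_top sequentially"
    using filterlim_cong[OF refl refl ev] T by simp
  \<comment> \<open>The coercion to \<open>ennreal\<close> sends negative values to 0, so the
    positive part defines the same measure.\<close>
  define F where "F n x = max 0 (f (S n) x)" for n x
  note [measurable] = g(1) f(1)[OF S] A
  have [measurable]: "F n \<in> borel_measurable M" for n unfolding F_def[abs_def] by simp
  have dens: "density M (f (S n)) = density M (F n)" for n
    by (intro density_cong) (auto simp: F_def max_def ennreal_neg)
  have mass: "(\<integral>\<^sup>+x. ennreal (F n x) \<partial>M) = 1" "(\<integral>\<^sup>+x. ennreal (g x) \<partial>M) = 1" for n
    using prob_space.emeasure_space_1[OF f(2)[OF S[of n]]] prob_space.emeasure_space_1[OF g(3)]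
    by (simp_all add: dens emeasure_density cong: nn_integral_cong)
  have int: "integrable M g" "integrable M (F n)" for n
    using mass g(2) by (auto intro!: integrableI_bounded simp: F_def)
  have L1: "(\<lambda>n. \<integral>\<^sup>+ x. norm (F n x - g x) \<partial>M) \<longlonglongrightarrow> 0"
  proof (rule Scheffe_lemma2)
    show "AE x in M. (\<lambda>n. F n x) \<longlonglongrightarrow> g x"
    proof (rule AE_I2)
      fix x
      have "(\<lambda>n. max 0 (f (S n) x)) \<longlonglongrightarrow> max 0 (g x)"
        by (intro tendsto_max tendsto_const filterlim_compose[OF lim Stop])
      then show "(\<lambda>n. F n x) \<longlonglongrightarrow> g x" using g(2) by (simp add: F_def)
    qed
    show "(\<integral>\<^sup>+ x. norm (F n x) \<partial>M) \<le> (\<integral>\<^sup>+ x. norm (g x) \<partial>M)" for n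
      using mass g(2) by (simp add: F_def)
  qed (use int in auto)
  have set: "measure (density M h) A = (\<integral>x. indicator A x * h x \<partial>M)"
    if "integrable M h" "\<And>x. h x \<ge> 0" for h
  proof -
    have [measurable]: "h \<in> borel_measurable M" using that(1) by simp
    have "emeasure (density M h) A = (\<integral>\<^sup>+x. ennreal (indicator A x * h x) \<partial>M)"
      by (subst emeasure_density) (auto intro!: nn_integral_cong simp: indicator_def)
    also have "\<dots> = ennreal (\<integral>x. indicator A x * h x \<partial>M)"
      using integrable_mult_indicator[OF A that(1)] that(2)
      by (intro nn_integral_eq_integral) auto
    finally show ?thesis
      using that(2) by (simp add: measure_def)
  qed
  have "(\<lambda>n. measure (density M (F n)) A) \<longlonglongrightarrow> measure (density M g) A"
  proof -
    \<comment> \<open>Restriction to \<open>A\<close> cannot increase the L1 distance.\<close>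
    have "(\<lambda>n. \<integral>x. indicator A x * F n x \<partial>M) \<longlonglongrightarrow> (\<integral>x. indicator A x * g x \<partial>M)"
    proof (rule tendsto_L1_int)
      show "integrable M (\<lambda>x. indicator A x * F n x)" "integrable M (\<lambda>x. indicator A x * g x)" for n
        using integrable_mult_indicator[OF A int(1)] integrable_mult_indicator[OF A int(2)] by simp_all
      show "(\<lambda>n. \<integral>\<^sup>+x. norm (indicator A x * F n x - indicator A x * g x) \<partial>M) \<longlonglongrightarrow> 0"
        by (rule tendsto_sandwich[OF _ _ tendsto_const L1])
          (auto intro!: nn_integral_mono always_eventually simp: indicator_def)
    qed
    then show ?thesis using g(2) int by (subst set, simp, simp add: F_def, subst set, simp_all)
  qed
  then have "(\<lambda>n. measure (density M (f (S n))) A) \<longlonglongrightarrow> measure (density M g) A"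
    by (simp add: dens)
  then show "(\<lambda>n. measure (density M (f (T n))) A) \<longlonglongrightarrow> measure (density M g) A"
    by (rule Lim_transform_eventually) (use ev in eventually_elim, simp)
qed

text \<open>Substitution \<open>y = b + c * z\<close>, with Jacobian \<open>c\<close>.\<close>

lemma distr_density_lborel_affine:
  fixes f :: "real \<Rightarrow> real"
  assumes c: "c > 0" and f [measurable]: "f \<in> borel_measurable borel"
  shows "distr (density lborel f) borel (\<lambda>y. (y - b) / c) = density lborel (\<lambda>z. c * f (b + c * z))"
proof (rule measure_eqI)
  fix A assume "A \<in> sets (distr (density lborel f) borel (\<lambda>y. (y - b) / c))"
  then have A [measurable]: "A \<in> sets borel" by simp
  have "emeasure (distr (density lborel f) borel (\<lambda>y. (y - b) / c)) A
          = (\<integral>\<^sup>+y. ennreal (f y) * indicator ((\<lambda>y. (y - b) / c) -` A) y \<partial>lborel)"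
    using measurable_sets[of "\<lambda>y. (y - b) / c" borel borel A]
    by (subst emeasure_distr) (auto simp: emeasure_density)
  also have "\<dots> = (\<integral>\<^sup>+y. ennreal (f y) * indicator A ((y - b) / c) \<partial>lborel)"
    by (simp add: indicator_def)
  also have "\<dots> = ennreal \<bar>c\<bar> * (\<integral>\<^sup>+z. ennreal (f (b + c * z)) * indicator A (((b + c * z) - b) / c) \<partial>lborel)"
    using c by (intro nn_integral_real_affine) auto
  also have "\<dots> = (\<integral>\<^sup>+z. ennreal (c * f (b + c * z)) * indicator A z \<partial>lborel)"
    using c by (subst nn_integral_cmult[symmetric]) (auto simp: ennreal_mult' mult_ac)
  also have "\<dots> = emeasure (density lborel (\<lambda>z. c * f (b + c * z))) A"
    by (simp add: emeasure_density)
  finally show "emeasure (distr (density lborel f) borel (\<lambda>y. (y - b) / c)) A =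
      emeasure (density lborel (\<lambda>z. c * f (b + c * z))) A" .
qed simp

theorem theorem5p15:
  fixes M :: "'a measure" and X :: "real \<Rightarrow> 'a \<Rightarrow> real" and k l :: real
  assumes "k > 0" and "l \<noteq> 0"
    and "dunkl_process M X k l"
    and "AE \<omega> in M. X 0 \<omega> = 0"
  shows "weak_conv_along (\<lambda>t. distr M borel (\<lambda>\<omega>. (X t \<omega> - t * l) / sqrt t))
           std_normal_distribution at_top"
proof -
  \<comment> \<open>The density of the rescaled variable, from the affine substitution with shift
    \<open>t * l\<close> and scale \<open>sqrt t\<close>.\<close>
  define f where "f t z = sqrt t * dunkl_transition_density k l t 0 (t * l + sqrt t * z)" for t z
  note k = \<open>k > 0\<close>
  have K: "feller_kernels (dunkl_transition k l)" and mp: "markov_process M X (dunkl_transition k l)"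
    using \<open>dunkl_process M X k l\<close> by (auto simp: dunkl_process_def feller_process_def)
  have [measurable]: "dunkl_transition_density k l t 0 \<in> borel_measurable borel" for t
    by (rule borel_measurable_dunkl_transition_density_0[OF k])
  have f_meas [measurable]: "f t \<in> borel_measurable borel" for t
    unfolding f_def[abs_def] by measurable
  have tr: "dunkl_transition k l t 0 = density lborel (dunkl_transition_density k l t 0)" if "t > 0" for t
    using that by (simp add: dunkl_transition_def)
  have D: "distr (dunkl_transition k l t 0) borel (\<lambda>y. (y - t * l) / sqrt t) = density lborel (f t)"
    if "t > 0" for t
    using that unfolding tr[OF that] f_def[abs_def]
    by (intro distr_density_lborel_affine) auto
  \<comment> \<open>Mass one is inherited from the Feller kernel and carried through the affine map,
    so no integral of the Dunkl kernel is evaluated.\<close>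
  have prob: "prob_space (density lborel (f t))" if t: "t > 0" for t
  proof -
    have "dunkl_transition k l t \<in> borel \<rightarrow>\<^sub>M prob_algebra borel"
      using K t by (simp add: feller_kernels_def)
    then have "dunkl_transition k l t 0 \<in> space (prob_algebra borel)"
      by (rule measurable_space) simp
    then have "prob_space (dunkl_transition k l t 0)" "sets (dunkl_transition k l t 0) = sets borel"
      by (auto simp: space_prob_algebra)
    then show ?thesis
      unfolding D[OF t, symmetric]
      by (intro prob_space.prob_space_distr) (auto cong: measurable_cong_sets)
  qed
  \<comment> \<open>The event for the rescaled variable is pulled back to \<open>X t\<close>,
    translated by the law from the origin, and pushed forward again.\<close>
  have cdf: "cdf (distr M borel (\<lambda>\<omega>. (X t \<omega> - t * l) / sqrt t)) x = measure (density lborel (f t)) {..x}"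
    if t: "t > 0" for t x
  proof -
    let ?A = "(\<lambda>y. (y - t * l) / sqrt t) -` {..x}"
    have A: "?A \<in> sets borel"
      using measurable_sets[of "\<lambda>y. (y - t * l) / sqrt t" borel borel "{..x}"] by simp
    have [measurable]: "X t \<in> borel_measurable M"
      using mp t by (simp add: markov_process_def)
    have "cdf (distr M borel (\<lambda>\<omega>. (X t \<omega> - t * l) / sqrt t)) x = measure M (X t -` ?A \<inter> space M)"
      unfolding cdf_def by (subst measure_distr) (auto intro!: arg_cong[where f = "measure M"])
    also have "\<dots> = measure (dunkl_transition k l t 0) ?A"
      using t by (intro markov_process_distr[OF mp _ assms(4) A]) auto
    also have "\<dots> = measure (distr (dunkl_transition k l t 0) borel (\<lambda>y. (y - t * l) / sqrt t)) {..x}"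
      unfolding tr[OF t] by (subst measure_distr) auto
    finally show ?thesis by (simp add: D[OF t])
  qed
  have lim: "((\<lambda>t. f t z) \<longlongrightarrow> std_normal_density z) at_top" for z
    unfolding f_def by (rule rescaled_dunkl_density_tendsto[OF k \<open>l \<noteq> 0\<close>])
  have "((\<lambda>t. cdf (distr M borel (\<lambda>\<omega>. (X t \<omega> - t * l) / sqrt t)) x) \<longlongrightarrow> cdf std_normal_distribution x) at_top"
    for x
  proof (rule Lim_transform_eventually)
    show "((\<lambda>t. measure (density lborel (f t)) {..x}) \<longlongrightarrow> cdf std_normal_distribution x) at_top"
      unfolding cdf_def
      by (rule tendsto_measure_density_Scheffe)
        (use prob lim prob_space_normal_density in auto)
    show "eventually (\<lambda>t. measure (density lborel (f t)) {..x} =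
        cdf (distr M borel (\<lambda>\<omega>. (X t \<omega> - t * l) / sqrt t)) x) at_top"
      using eventually_gt_at_top[of 0] by eventually_elim (simp add: cdf)
  qed
  then show ?thesis by (simp add: weak_conv_along_def)
qed

end
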